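(* If $P \in \mathcal{H}_n$ and $\lambda_1, \lambda_2 \in \mathbb{R}$ are such that $\lambda_1\lambda_2 \ge 0$ and $|\lambda_1| \le |\lambda_2|$, then $D_{\lambda_1}P \preccurlyeq D_{\lambda_2}P$.
   Context: $\mathcal{H}_n$ denotes the set of monic hyperbolic polynomials of degree $n$, i.e. monic polynomials of degree $n$ all of whose zeros are real. For a polynomial $P$ of degree $n$, $Z(P)$ is the unordered $n$-tuple of its zeros, each repeated according to multiplicity. For two unordered $n$-tuples $X=(x_1,\dots,x_n)$ and $Y=(y_1,\dots,y_n)$ of real numbers, $X \prec Y$ ($X$ is majorized by $Y$, or less than $Y$ in the spectral order) means that $\sum_{i=1}^n f(x_i) \le \sum_{i=1}^n f(y_i)$ for every convex function $f:\mathbb{R}\to\mathbb{R}$; equivalently, there is a doubly stochastic $n\times n$ matrix $A$ with $(x_1,\dots,x_n)^t = A (y_1,\dots,y_n)^t$. For $P,Q\in\mathcal{H}_n$, $P \preccurlyeq Q$ means $Z(P) \prec Z(Q)$. For $\lambda\in\mathbb{R}$, $D_\lambda = \left(1-\lambda\frac{d}{dx}\right)e^{\lambda\frac{d}{dx}}$, that is, $(D_\lambda P)(x) = P(x+\lambda) - \lambda P'(x+\lambda)$. By the Hermite–Poulain theorem, $D_\lambda$ maps $\mathcal{H}_n$ into $\mathcal{H}_n$. *)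

theory Defs
  imports
    "HOL-Analysis.Analysis"
    "HOL-Computational_Algebra.Computational_Algebra"
begin

definition hyperbolic_polys :: "nat \<Rightarrow> real poly set" where
  "hyperbolic_polys n =
     {P. degree P = n \<and> lead_coeff P = 1 \<and>
         (\<forall>z. poly (map_poly complex_of_real P) z = 0 \<longrightarrow> z \<in> \<real>)}"

(* An unordered n-tuple is a multiset of size n. *)
definition majorized :: "real multiset \<Rightarrow> real multiset \<Rightarrow> bool" where
  "majorized X Y \<longleftrightarrow> size X = size Y \<and>
     (\<forall>f. convex_on UNIV f \<longrightarrow> (\<Sum>x\<in>#X. f x) \<le> (\<Sum>y\<in>#Y. f y))"

(* proots collects the real zeros with multiplicity; on hyperbolic_polys n these are
   all n zeros, see size_proots_hyperbolic below. *)
definition spectral_le :: "real poly \<Rightarrow> real poly \<Rightarrow> bool" where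
  "spectral_le P Q \<longleftrightarrow> majorized (proots P) (proots Q)"

(* The operator (1 - l d/dx) exp(l d/dx); the second factor is translation by l. *)
definition D_op :: "real \<Rightarrow> real poly \<Rightarrow> real poly" where
  "D_op l P = pcompose P [:l, 1:] - smult l (pderiv (pcompose P [:l, 1:]))"

lemma poly_D_op: "poly (D_op l P) x = poly P (x + l) - l * poly (pderiv P) (x + l)"
  by (simp add: D_op_def poly_pcompose pderiv_pcompose pderiv_pCons add.commute)

lemma map_poly_complex_of_real_simps:
  "map_poly complex_of_real (p * q) = map_poly complex_of_real p * map_poly complex_of_real q"
  "map_poly complex_of_real (p + q) = map_poly complex_of_real p + map_poly complex_of_real q"
  "map_poly complex_of_real (p - q) = map_poly complex_of_real p - map_poly complex_of_real q"
  "map_poly complex_of_real (smult c p) = smult (complex_of_real c) (map_poly complex_of_real p)"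
  by (rule poly_eqI, simp add: coeff_map_poly coeff_mult)+

lemma hyperbolic_split:
  assumes "P \<in> hyperbolic_polys n"
  shows "\<exists>A. size A = n \<and> P = (\<Prod>x\<in>#A. [:-x, 1:])"
proof -
  let ?h = "map_poly complex_of_real"
  let ?q = "?h P"
  have inj: "P1 = P2" if "?h P1 = ?h P2" for P1 P2
    using that by (metis coeff_map_poly of_real_0 of_real_eq_iff poly_eqI)
  have deg: "degree ?q = n" and lc: "lead_coeff ?q = 1"
    using assms by (auto simp: hyperbolic_polys_def degree_map_poly coeff_map_poly)
  then have nz: "?q \<noteq> 0" by auto
  define A where "A = image_mset Re (proots ?q)"
  have sz: "size A = n"
    using deg by (simp add: A_def size_proots_complex)
  have re: "complex_of_real (Re z) = z" if "z \<in># proots ?q" for z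
    using that nz assms by (auto simp: hyperbolic_polys_def)
  have hprod: "?h (\<Prod>x\<in>#B. [:-x, 1:]) = (\<Prod>x\<in>#B. [:-of_real x, 1:])" for B
    by (induction B)
      (simp_all add: map_poly_complex_of_real_simps map_poly_pCons del: mult_pCons_left)
  have "?q = (\<Prod>x\<in>#proots ?q. [:-x, 1:])"
    using complex_poly_decompose_multiset[of ?q] lc by simp
  also have "\<dots> = (\<Prod>x\<in>#proots ?q. [:-of_real (Re x), 1:])"
    by (rule arg_cong[where f = prod_mset], rule image_mset_cong) (simp add: re)
  also have "\<dots> = ?h (\<Prod>x\<in>#A. [:-x, 1:])"
    unfolding hprod by (simp add: A_def image_mset.compositionality comp_def)
  finally show ?thesis using sz inj by blast
qed

lemma size_proots_hyperbolic:
  assumes "P \<in> hyperbolic_polys n"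
  shows "size (proots P) = n"
proof -
  obtain A where A: "size A = n" "P = (\<Prod>x\<in>#A. [:-x, 1:])"
    using hyperbolic_split[OF assms] by blast
  have "proots (\<Prod>x\<in>#B. [:-x, 1:]) = B" for B :: "real multiset"
  proof (induction B)
    case (add x B)
    have "(\<Prod>x\<in>#B. [:-x, 1:]) \<noteq> 0" by (auto simp: prod_mset_zero_iff)
    then have "proots ([:-x, 1:] * (\<Prod>x\<in>#B. [:-x, 1:])) = {#x#} + B"
      using add by (subst proots_mult) (simp_all del: mult_pCons_left)
    then show ?case by (simp del: mult_pCons_left)
  qed simp
  with A show ?thesis by simp
qed

lemma log_deriv_nonreal:
  assumes "Im w \<noteq> 0"
  shows "\<exists>S. poly (map_poly complex_of_real (pderiv (\<Prod>x\<in>#A. [:-x, 1:]))) w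
              = poly (map_poly complex_of_real (\<Prod>x\<in>#A. [:-x, 1:])) w * S
           \<and> Im S * Im w \<le> 0 \<and> (Im S = 0 \<longrightarrow> S = 0)"
proof (induction A)
  case empty
  show ?case by (intro exI[of _ 0]) simp
next
  case (add x A)
  let ?h = "map_poly complex_of_real"
  let ?p = "\<Prod>x\<in>#A. [:-x, 1:]"
  obtain S where S: "poly (?h (pderiv ?p)) w = poly (?h ?p) w * S"
    "Im S * Im w \<le> 0" "Im S = 0 \<longrightarrow> S = 0" using add by blast
  have wx: "w - of_real x \<noteq> 0" using assms by (auto simp: complex_eq_iff)
  let ?T = "S + 1 / (w - of_real x)"
  have "Im (1 / (w - of_real x)) * Im w = - ((Im w)\<^sup>2 / (cmod (w - of_real x))\<^sup>2)"
    by (simp add: Im_divide cmod_power2) (simp add: power2_eq_square)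
  also have "\<dots> < 0" using assms wx by simp
  finally have neg: "Im ?T * Im w < 0" using S(2) by (simp add: algebra_simps)
  have "pderiv ([:-x, 1:] * ?p) = [:-x, 1:] * pderiv ?p + ?p"
    by (simp add: pderiv_mult pderiv_pCons del: mult_pCons_left)
  then have "poly (?h (pderiv ([:-x, 1:] * ?p))) w
      = (w - of_real x) * (poly (?h ?p) w * S) + poly (?h ?p) w"
    using S(1) by (simp add: map_poly_complex_of_real_simps map_poly_pCons algebra_simps del: mult_pCons_left)
  also have "\<dots> = (w - of_real x) * poly (?h ?p) w * ?T"
    using wx by (simp add: field_simps)
  also have "\<dots> = poly (?h ([:-x, 1:] * ?p)) w * ?T"
    by (simp add: map_poly_complex_of_real_simps map_poly_pCons del: mult_pCons_left)
  finally show ?case using neg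
    by (intro exI[of _ ?T]) (auto simp del: mult_pCons_left)
qed

text \<open>Hermite--Poulain: \<open>D_op l\<close> maps monic hyperbolic polynomials to such polynomials.\<close>

lemma D_op_hyperbolic:
  assumes P: "P \<in> hyperbolic_polys n"
  shows "D_op l P \<in> hyperbolic_polys n"
proof -
  let ?h = "map_poly complex_of_real"
  define Q where "Q = pcompose P [:l, 1:]"
  have D: "D_op l P = Q - smult l (pderiv Q)" by (simp add: D_op_def Q_def)
  have Qdeg: "degree Q = n" and Qlc: "coeff Q n = 1"
    using P lead_coeff_comp[of "[:l, 1:]" P]
    by (auto simp: Q_def hyperbolic_polys_def degree_pcompose)
  have c: "coeff (D_op l P) n = 1"
    using Qdeg Qlc by (simp add: D coeff_pderiv coeff_eq_0)
  have "degree (D_op l P) \<le> n"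
    unfolding D using Qdeg
    by (intro degree_diff_le) (auto intro: order.trans[OF degree_smult_le] simp: degree_pderiv)
  then have deg: "degree (D_op l P) = n"
    using c le_degree[of "D_op l P" n] by simp
  obtain A where A: "P = (\<Prod>x\<in>#A. [:-x, 1:])"
    using hyperbolic_split[OF P] by blast
  have hcomp: "?h (pcompose a [:l, 1:]) = pcompose (?h a) [:of_real l, 1:]" for a
    by (induction a) (simp_all add: pcompose_pCons map_poly_complex_of_real_simps map_poly_pCons
        del: mult_pCons_left)
  have dQ: "pderiv Q = pcompose (pderiv P) [:l, 1:]"
    by (simp add: Q_def pderiv_pcompose pderiv_pCons)
  have "z \<in> \<real>" if z: "poly (?h (D_op l P)) z = 0" for z
  proof (rule ccontr)
    assume nr: "z \<notin> \<real>"
    let ?w = "of_real l + z"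
    have im: "Im ?w \<noteq> 0" using nr by (simp add: complex_is_Real_iff)
    obtain S where S: "poly (?h (pderiv P)) ?w = poly (?h P) ?w * S"
      "Im S = 0 \<longrightarrow> S = 0" using log_deriv_nonreal[OF im, of A] A by blast
    have "poly (?h P) ?w \<noteq> 0"
      using P im by (auto simp: hyperbolic_polys_def complex_is_Real_iff)
    moreover have "poly (?h P) ?w - of_real l * poly (?h (pderiv P)) ?w = 0"
      using z unfolding D dQ by (simp add: Q_def map_poly_complex_of_real_simps hcomp poly_pcompose)
    then have "poly (?h P) ?w * (1 - of_real l * S) = 0"
      unfolding S(1) by (simp add: algebra_simps)
    ultimately have one: "of_real l * S = 1" by simp
    then have "Im (of_real l * S) = 0" by simp
    then have "l = 0 \<or> Im S = 0" by simp
    then show False using one S(2) by auto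
  qed
  with c deg show ?thesis by (simp add: hyperbolic_polys_def)
qed

end

theory Submission
  imports Defs "Jordan_Normal_Form.Char_Poly"
begin

text \<open>
  The zeros of \<open>D_op l P\<close> are the eigenvalues of a real symmetric matrix that is affine in \<open>l\<close>. Let
  \<open>x\<^sub>0, \<dots>, x\<^sub>n\<^sub>-\<^sub>1\<close> be the zeros of \<open>P\<close>, let \<open>X\<close> be the diagonal matrix with these entries and
  let \<open>M l\<close> have the diagonal of \<open>X\<close> and \<open>l\<close> in all other places. Then \<open>M l - X\<close> is \<open>l\<close> times the
  all-ones matrix minus \<open>l\<close> times the identity. The identity part translates the spectrum by \<open>- l\<close>, and
  the rank-one part turns \<open>P\<close> into \<open>P - l P'\<close>, so that the characteristic polynomial of \<open>M l\<close> is
  \<open>D_op l P\<close> (\<open>char_poly_const_off_diag\<close>).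

  For convex \<open>f\<close> let \<open>Tr f A\<close> be the sum of \<open>f\<close> over the eigenvalues of a symmetric matrix \<open>A\<close>. By
  Schur and Peierls, the sum of \<open>f\<close> over the diagonal of \<open>A\<close>, in any orthonormal basis, is at
  most \<open>Tr f A\<close> (\<open>sum_convex_diagonal_le\<close>). This has two consequences. First, \<open>Tr f\<close> is convex, as is
  seen in an eigenbasis of the convex combination. Secondly, \<open>Tr f X \<le> Tr f (M l)\<close> for all \<open>l\<close>,
  because \<open>X\<close> is the diagonal of \<open>M l\<close>. Hence \<open>l \<mapsto> Tr f (M l)\<close> is a convex function with its minimum
  at \<open>0\<close>, and such a function is monotone on either side of \<open>0\<close>. The two consequences are combined in
  \<open>sum_convex_spectrum_le\<close>.

  The argument does not distinguish simple from multiple zeros, or positive from negative parameters.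
  Since the zeros of \<open>D_op l P\<close> are known to be real by Hermite and Poulain, the spectral theorem is
  needed only for a symmetric matrix whose characteristic polynomial is given as a product of real
  linear factors (\<open>symmetric_diagonalize\<close>).
\<close>

section \<open>Diagonalization of symmetric matrices\<close>

text \<open>
  Completes a unit vector to an orthonormal basis: the reflection that interchanges \<open>v\<close> with the first
  unit vector is symmetric and orthogonal at once.
\<close>

lemma householder_reflection:
  fixes v :: "nat \<Rightarrow> real"
  assumes n: "0 < n" and unit: "(\<Sum>k<n. v k * v k) = 1"
  obtains H where "H \<in> carrier_mat n n" "transpose_mat H = H" "H * H = 1\<^sub>m n" "col H 0 = Matrix.vec n v"
proof (cases "v 0 = 1")
  case True
  have "(\<Sum>k<n. v k * v k) = 1 + (\<Sum>k\<in>{..<n} - {0}. v k * v k)"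
    using n True by (subst sum.remove[of _ 0]) auto
  then have "(\<Sum>k\<in>{..<n} - {0}. v k * v k) = 0"
    using unit by simp
  then have z: "v k = 0" if "k < n" "k \<noteq> 0" for k
    using that by (subst (asm) sum_nonneg_eq_0_iff) auto
  have "col (1\<^sub>m n) 0 = Matrix.vec n v"
    using n True z by (intro eq_vecI) auto
  then show ?thesis
    by (intro that[of "1\<^sub>m n"]) auto
next
  case False
  define w where "w = (\<lambda>i. v i - (if i = 0 then 1 else 0))"
  \<comment> \<open>\<open>w = v - e\<^sub>0\<close> is normal to the mirror; \<open>c = 2 / (w \<bullet> w)\<close>, as \<open>w \<bullet> w = 2 (1 - v 0)\<close> for a unit vector.\<close>
  define c where "c = 1 / (1 - v 0)"
  define H where "H = Matrix.mat n n (\<lambda>(i, j). (if i = j then 1 else 0) - c * w i * w j)"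
  have "(\<Sum>k<n. w k * w k)
      = (\<Sum>k<n. v k * v k) + (\<Sum>k<n. if k = 0 then 1 - 2 * v 0 else 0)"
    unfolding sum.distrib[symmetric] w_def by (rule sum.cong) (auto simp: algebra_simps)
  also have "\<dots> = 2 * (1 - v 0)"
    using n unit by simp
  finally have ww: "c * (\<Sum>k<n. w k * w k) = 2"
    using False by (simp add: c_def field_simps)
  have "H * H = 1\<^sub>m n"
  proof (rule eq_matI)
    fix i j assume "i < dim_row (1\<^sub>m n :: real mat)" "j < dim_col (1\<^sub>m n :: real mat)"
    then have ij: "i < n" "j < n" by auto
    have "(H * H) $$ (i, j)
        = (\<Sum>k<n. ((if i = k then 1 else 0) - c * w i * w k) * ((if k = j then 1 else 0) - c * w k * w j))"
      using ij by (simp add: H_def scalar_prod_def lessThan_atLeast0)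
    also have "\<dots> = (\<Sum>k<n. (if k = i then (if k = j then 1 else 0) else 0)
        - (if k = i then c * w i * w j else 0) - (if k = j then c * w i * w j else 0)
        + c * w i * w j * c * (w k * w k))"
      by (rule sum.cong) (auto simp: algebra_simps)
    also have "\<dots> = (if i = j then 1 else 0) - 2 * (c * w i * w j)
        + c * w i * w j * (c * (\<Sum>k<n. w k * w k))"
      using ij by (simp add: sum.distrib sum_subtractf sum_distrib_left mult.assoc)
    finally show "(H * H) $$ (i, j) = 1\<^sub>m n $$ (i, j)"
      using ij by (simp add: ww)
  qed (auto simp: H_def)
  moreover have "col H 0 = Matrix.vec n v"
    using n False by (intro eq_vecI) (auto simp: H_def w_def c_def field_simps)
  moreover have "transpose_mat H = H"
    by (intro eq_matI) (auto simp: H_def)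
  ultimately show ?thesis
    by (intro that[of H]) (auto simp: H_def)
qed


text \<open>
  Deflation by induction on the list of zeros: a reflection moves a unit eigenvector for \<open>e\<close> to the first
  coordinate axis, symmetry then clears the first row along with the first column, and the remaining
  block has the characteristic polynomial with the factor for \<open>e\<close> removed. Assuming the real
  factorization makes it pass to that block, which spares an argument for the reality of the spectrum.
\<close>
lemma symmetric_diagonalize:
  fixes A :: "real mat"
  assumes "A \<in> carrier_mat n n" "transpose_mat A = A" "char_poly A = (\<Prod>e\<leftarrow>es. [:-e, 1:])"
  shows "\<exists>U\<in>carrier_mat n n. transpose_mat U * U = 1\<^sub>m n \<and>
           A = U * mat_diag n ((!) es) * transpose_mat U"
  using assms
proof (induction es arbitrary: A n)
  case Nil
  have "n = 0"
    using degree_monic_char_poly[OF Nil.prems(1)] Nil.prems(3) by simp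
  then show ?case
    using Nil.prems by (intro bexI[of _ "1\<^sub>m 0"]) auto
next
  case (Cons e es)
  note A = Cons.prems(1) and sym = Cons.prems(2)
  have "n = length (e # es)"
    using degree_monic_char_poly[OF A] Cons.prems(3) degree_linear_factors[of uminus "e # es"] by simp
  then obtain m where nm: "n = Suc m" by auto
  have "poly (char_poly A) e = 0"
    unfolding Cons.prems(3) by simp
  then have "eigenvalue A e"
    using eigenvalue_root_char_poly[OF A] by simp
  then obtain v where v: "v \<in> carrier_vec n" "v \<noteq> 0\<^sub>v n" "A *\<^sub>v v = e \<cdot>\<^sub>v v"
    using A unfolding eigenvalue_def eigenvector_def by auto
  define s where "s = (\<Sum>k<n. (vec_index v k)\<^sup>2)"
  have "s \<noteq> 0"
  proof
    assume "s = 0"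
    then have "\<forall>k\<in>{..<n}. (vec_index v k)\<^sup>2 = 0"
      unfolding s_def by (subst (asm) sum_nonneg_eq_0_iff) auto
    then have "v = 0\<^sub>v n"
      using v(1) by (intro eq_vecI) auto
    with v(2) show False by simp
  qed
  then have s: "s > 0"
    unfolding s_def by (metis order_le_less sum_nonneg zero_le_power2)
  define u where "u = (\<lambda>k. vec_index v k / sqrt s)"
  have u_vec: "Matrix.vec n u = (1 / sqrt s) \<cdot>\<^sub>v v"
    using v(1) by (intro eq_vecI) (auto simp: u_def)
  have "(\<Sum>k<n. u k * u k) = s / s"
    using s unfolding u_def by (simp add: sum_divide_distrib[symmetric]) (simp add: s_def power2_eq_square)
  then have unit: "(\<Sum>k<n. u k * u k) = 1"
    using s by simp
  have Au: "A *\<^sub>v Matrix.vec n u = e \<cdot>\<^sub>v Matrix.vec n u"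
    unfolding u_vec using A v by (simp add: mult_mat_vec smult_smult_assoc mult.commute)
  obtain H where H: "H \<in> carrier_mat n n" "transpose_mat H = H" "H * H = 1\<^sub>m n" "col H 0 = Matrix.vec n u"
    using householder_reflection[OF _ unit] nm by blast
  define B where "B = H * A * H"
  have B: "B \<in> carrier_mat n n" using H(1) A by (simp add: B_def)
  have B_sym: "transpose_mat B = B"
    using H A sym by (simp add: B_def transpose_mult[of _ n n _ n] assoc_mult_mat[of _ n n _ n _ n])
  have A_B: "A = H * B * H"
  proof -
    have "H * B * H = (H * H) * A * (H * H)"
      unfolding B_def using H(1) A by (simp add: assoc_mult_mat[of _ n n _ n _ n])
    then show ?thesis using H(3) A by simp
  qed
  have "col B 0 = (H * A) *\<^sub>v col H 0"
    unfolding B_def using H(1) A nm by (intro col_mult2[of _ n n _ n]) auto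
  also have "\<dots> = H *\<^sub>v (A *\<^sub>v Matrix.vec n u)"
    unfolding H(4) using H(1) A by (intro assoc_mult_mat_vec[of _ n n _ n]) auto
  also have "\<dots> = e \<cdot>\<^sub>v (H *\<^sub>v col H 0)"
    unfolding Au H(4) using H(1) by (intro mult_mat_vec[of _ n n]) auto
  also have "H *\<^sub>v col H 0 = col (H * H) 0"
    using H(1) nm by (intro col_mult2[symmetric, of _ n n _ n]) auto
  finally have col0: "col B 0 = e \<cdot>\<^sub>v unit_vec n 0"
    using H(3) nm by simp
  have B_i0: "B $$ (i, 0) = (if i = 0 then e else 0)" if "i < n" for i
  proof -
    have "B $$ (i, 0) = vec_index (col B 0) i" using B that nm by simp
    then show ?thesis unfolding col0 using that nm by simp
  qed
  have B_0i: "B $$ (0, i) = (if i = 0 then e else 0)" if "i < n" for i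
    using B_i0[OF that] B_sym B that nm by (metis index_transpose_mat(1) carrier_matD zero_less_Suc)
  define A' where "A' = Matrix.mat m m (\<lambda>(i, j). B $$ (Suc i, Suc j))"
  have A': "A' \<in> carrier_mat m m" by (simp add: A'_def)
  have blocks: "B = four_block_mat (Matrix.mat 1 1 (\<lambda>_. e)) (0\<^sub>m 1 m) (0\<^sub>m m 1) A'"
    using B nm B_i0 B_0i by (intro eq_matI) (auto simp: A'_def)
  have sym': "transpose_mat A' = A'"
  proof (rule eq_matI)
    fix i j assume "i < dim_row A'" "j < dim_col A'"
    then have "i < m" "j < m" using A' by auto
    then show "transpose_mat A' $$ (i, j) = A' $$ (i, j)"
      using B nm index_transpose_mat(1)[of "Suc j" B "Suc i"] unfolding B_sym by (simp add: A'_def)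
  qed (use A' in auto)
  have "similar_mat A B"
    unfolding similar_mat_def similar_mat_wit_def Let_def
    using A B H(1,3) A_B by (intro exI[of _ H]) auto
  then have "char_poly A = char_poly B"
    by (rule char_poly_similar)
  also have "\<dots> = [:-e, 1:] * char_poly A'"
    unfolding blocks using A'
    by (subst char_poly_four_block_zeros_col) (auto simp: char_poly_defs det_single)
  finally have "[:-e, 1:] * char_poly A' = [:-e, 1:] * (\<Prod>e\<leftarrow>es. [:-e, 1:])"
    using Cons.prems(3) by (simp del: mult_pCons_left)
  then have "char_poly A' = (\<Prod>e\<leftarrow>es. [:-e, 1:])"
    by (subst (asm) mult_cancel_left) auto
  from Cons.IH[OF A' sym' this] obtain U' where U': "U' \<in> carrier_mat m m"
    "transpose_mat U' * U' = 1\<^sub>m m" "A' = U' * mat_diag m ((!) es) * transpose_mat U'" by blast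
  define V where "V = four_block_mat (1\<^sub>m 1) (0\<^sub>m 1 m) (0\<^sub>m m 1) U'"
  have V: "V \<in> carrier_mat n n"
    using four_block_carrier_mat[of "1\<^sub>m 1" 1 1 U' m m "0\<^sub>m 1 m" "0\<^sub>m m 1"] U'(1) nm by (simp add: V_def)
  have Vt: "transpose_mat V = four_block_mat (1\<^sub>m 1) (0\<^sub>m 1 m) (0\<^sub>m m 1) (transpose_mat U')"
    unfolding V_def using U'(1) by (subst transpose_four_block_mat) auto
  have D: "mat_diag n ((!) (e # es))
      = four_block_mat (Matrix.mat 1 1 (\<lambda>_. e)) (0\<^sub>m 1 m) (0\<^sub>m m 1) (mat_diag m ((!) es))"
    using nm by (intro eq_matI) (auto simp: mat_diag_def)
  have "transpose_mat V * V = four_block_mat (1\<^sub>m 1) (0\<^sub>m 1 m) (0\<^sub>m m 1) (1\<^sub>m m)"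
    unfolding Vt unfolding V_def using U'(1,2)
    by (subst mult_four_block_mat[of _ 1 1 _ m _ m]) (auto intro!: cong_four_block_mat)
  then have VV: "transpose_mat V * V = 1\<^sub>m n"
    using four_block_one_mat[of 1 m] nm by simp
  have B_V: "B = V * mat_diag n ((!) (e # es)) * transpose_mat V"
  proof -
    have "V * mat_diag n ((!) (e # es))
        = four_block_mat (Matrix.mat 1 1 (\<lambda>_. e)) (0\<^sub>m 1 m) (0\<^sub>m m 1) (U' * mat_diag m ((!) es))"
      unfolding D V_def using U'(1) mat_diag_dim[of m "(!) es"]
      by (subst mult_four_block_mat[of _ 1 1 _ m _ m]) (auto intro!: cong_four_block_mat simp del: mat_diag_dim)
    also have "\<dots> * transpose_mat V = B"
      unfolding Vt blocks U'(3) using U'(1) mat_diag_dim[of m "(!) es"]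
      by (subst mult_four_block_mat[of _ 1 1 _ m _ m]) (auto intro!: cong_four_block_mat simp del: mat_diag_dim)
    finally show ?thesis by simp
  qed
  show ?case
  proof (intro bexI conjI)
    show "H * V \<in> carrier_mat n n" using H(1) V by simp
    have "transpose_mat (H * V) * (H * V) = transpose_mat V * (H * H) * V"
      using H(1,2) V by (simp add: transpose_mult[of _ n n _ n] assoc_mult_mat[of _ n n _ n _ n])
    then show "transpose_mat (H * V) * (H * V) = 1\<^sub>m n"
      using H(3) V VV by simp
    show "A = H * V * mat_diag n ((!) (e # es)) * transpose_mat (H * V)"
      unfolding A_B B_V using H(1,2) V mat_diag_dim[of n "(!) (e # es)"]
      by (simp del: mat_diag_dim add: transpose_mult[of _ n n _ n] assoc_mult_mat[of _ n n _ n _ n])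
  qed
qed


section \<open>Convex functions of the spectrum\<close>

text \<open>
  The diagonal of \<open>R\<^sup>T diag(d) R\<close> arises from \<open>d\<close> by the matrix of squared entries of \<open>R\<close>, which is
  doubly stochastic: the sums over one index allow the use of Jensen's inequality, the sums over the
  other index collect the result.
\<close>
lemma sum_convex_orthogonal_conj_le:
  fixes R :: "real mat"
  assumes R: "R \<in> carrier_mat n n" "transpose_mat R * R = 1\<^sub>m n" and f: "convex_on UNIV f"
  shows "(\<Sum>i<n. f ((transpose_mat R * mat_diag n d * R) $$ (i, i))) \<le> (\<Sum>k<n. f (d k))"
proof -
  define p where "p = (\<lambda>i k. (R $$ (k, i))\<^sup>2)"
  have p0: "0 \<le> p i k" for i k by (simp add: p_def)
  have col: "(\<Sum>k<n. p i k) = 1" if "i < n" for i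
  proof -
    have "(transpose_mat R * R) $$ (i, i) = (\<Sum>k<n. p i k)"
      using R(1) that by (simp add: scalar_prod_def p_def power2_eq_square lessThan_atLeast0)
    then show ?thesis using R(2) that by simp
  qed
  have row: "(\<Sum>i<n. p i k) = 1" if "k < n" for k
  proof -
    have "R * transpose_mat R = 1\<^sub>m n"
      by (rule mat_mult_left_right_inverse[of _ n]) (use R in auto)
    moreover have "(R * transpose_mat R) $$ (k, k) = (\<Sum>i<n. p i k)"
      using R(1) that by (simp add: scalar_prod_def p_def power2_eq_square lessThan_atLeast0)
    ultimately show ?thesis using that by simp
  qed
  have entry: "(transpose_mat R * mat_diag n d * R) $$ (i, i) = (\<Sum>k<n. p i k *\<^sub>R d k)" if "i < n" for i
    using R(1) that
    by (subst mat_diag_mult_right[of _ n n])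
      (auto simp: scalar_prod_def p_def power2_eq_square lessThan_atLeast0 mult_ac)
  have "f ((transpose_mat R * mat_diag n d * R) $$ (i, i)) \<le> (\<Sum>k<n. p i k * f (d k))" if "i < n" for i
    unfolding entry[OF that] using that col[OF that] p0 f
    by (intro convex_on_sum[of _ UNIV]) auto
  then have "(\<Sum>i<n. f ((transpose_mat R * mat_diag n d * R) $$ (i, i)))
      \<le> (\<Sum>i<n. \<Sum>k<n. p i k * f (d k))"
    by (intro sum_mono) auto
  also have "\<dots> = (\<Sum>k<n. (\<Sum>i<n. p i k) * f (d k))"
    by (subst sum.swap) (simp add: sum_distrib_right)
  also have "\<dots> = (\<Sum>k<n. f (d k))"
    by (simp add: row)
  finally show ?thesis .
qed

text \<open>
  The inequality of Schur and Peierls: the columns of \<open>W\<close> form an arbitrary orthonormal basis, and \<open>d\<close>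
  lists the eigenvalues of \<open>A\<close>.
\<close>
lemma sum_convex_diagonal_le:
  fixes A U W :: "real mat"
  assumes U: "U \<in> carrier_mat n n" "transpose_mat U * U = 1\<^sub>m n"
    and A: "A = U * mat_diag n d * transpose_mat U"
    and W: "W \<in> carrier_mat n n" "transpose_mat W * W = 1\<^sub>m n"
    and f: "convex_on UNIV f"
  shows "(\<Sum>i<n. f ((transpose_mat W * A * W) $$ (i, i))) \<le> (\<Sum>k<n. f (d k))"
proof -
  define R where "R = transpose_mat U * W"
  have Rc: "R \<in> carrier_mat n n" using U W by (simp add: R_def)
  have "U * transpose_mat U = 1\<^sub>m n"
    by (rule mat_mult_left_right_inverse[of _ n]) (use U in auto)
  moreover have "transpose_mat R * R = transpose_mat W * (U * transpose_mat U) * W"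
    unfolding R_def using U(1) W(1)
    by (simp add: transpose_mult[of _ n n _ n] assoc_mult_mat[of _ n n _ n _ n])
  ultimately have "transpose_mat R * R = 1\<^sub>m n"
    using W by simp
  moreover have "transpose_mat W * A * W = transpose_mat R * mat_diag n d * R"
    unfolding R_def A using U(1) W(1) mat_diag_dim[of n d]
    by (simp del: mat_diag_dim add: transpose_mult[of _ n n _ n] assoc_mult_mat[of _ n n _ n _ n])
  ultimately show ?thesis
    using sum_convex_orthogonal_conj_le[OF Rc _ f] by simp
qed

text \<open>
  On the segment from the diagonal part of \<open>Y\<close> to \<open>Y\<close>, no point has a larger \<open>Tr f\<close> than \<open>Y\<close>. The
  eigenvalue \<open>d i\<close> of a point of the segment is the convex combination of the two quadratic forms
  \<open>a i\<close> and \<open>b i\<close> at its \<open>i\<close>-th eigenvector. The inequality above bounds the sum of \<open>f (b i)\<close> directly, and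
  that of \<open>f (a i)\<close> by way of the diagonal of \<open>Y\<close>.
\<close>
lemma sum_convex_spectrum_le:
  fixes Y U V :: "real mat"
  assumes U: "U \<in> carrier_mat n n" "transpose_mat U * U = 1\<^sub>m n"
    and V: "V \<in> carrier_mat n n" "transpose_mat V * V = 1\<^sub>m n"
    and Y: "Y = V * mat_diag n e * transpose_mat V"
    and diag: "\<And>i. i < n \<Longrightarrow> Y $$ (i, i) = x i"
    and M: "(1 - \<theta>) \<cdot>\<^sub>m mat_diag n x + \<theta> \<cdot>\<^sub>m Y = U * mat_diag n d * transpose_mat U"
    and \<theta>: "0 \<le> \<theta>" "\<theta> \<le> 1"
    and f: "convex_on UNIV f"
  shows "(\<Sum>i<n. f (d i)) \<le> (\<Sum>i<n. f (e i))"
proof -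
  have Yc: "Y \<in> carrier_mat n n"
    unfolding Y using V(1) by (intro mult_carrier_mat[of _ n n]) auto
  define a where "a = (\<lambda>i. (transpose_mat U * mat_diag n x * U) $$ (i, i))"
  define b where "b = (\<lambda>i. (transpose_mat U * Y * U) $$ (i, i))"
  have "transpose_mat U * (U * mat_diag n d * transpose_mat U) * U
      = (transpose_mat U * U) * mat_diag n d * (transpose_mat U * U)"
    using U(1) mat_diag_dim[of n d] by (simp del: mat_diag_dim add: assoc_mult_mat[of _ n n _ n _ n])
  then have "mat_diag n d = transpose_mat U * ((1 - \<theta>) \<cdot>\<^sub>m mat_diag n x + \<theta> \<cdot>\<^sub>m Y) * U"
    unfolding M using U(2) by (simp add: right_mult_one_mat[of _ n n] left_mult_one_mat[of _ n n])
  also have "\<dots> = (1 - \<theta>) \<cdot>\<^sub>m (transpose_mat U * mat_diag n x * U) + \<theta> \<cdot>\<^sub>m (transpose_mat U * Y * U)"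
    using U(1) Yc mat_diag_dim[of n x]
    by (simp del: mat_diag_dim add: mult_add_distrib_mat[of _ n n _ n] add_mult_distrib_mat[of _ n n _ _ n]
        mult_smult_distrib[of _ n n _ n] mult_smult_assoc_mat[of _ n n _ n])
  finally have D: "mat_diag n d = \<dots>" .
  have d: "d i = (1 - \<theta>) * a i + \<theta> * b i" if "i < n" for i
    using arg_cong[OF D, of "\<lambda>M. M $$ (i, i)"] that U(1) Yc by (simp add: a_def b_def mat_diag_def)
  have "(\<Sum>i<n. f (a i)) \<le> (\<Sum>i<n. f (x i))"
    unfolding a_def using U f by (rule sum_convex_orthogonal_conj_le)
  also have "\<dots> = (\<Sum>i<n. f ((transpose_mat (1\<^sub>m n) * Y * 1\<^sub>m n) $$ (i, i)))"
    using Yc by (simp add: diag)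
  also have "\<dots> \<le> (\<Sum>i<n. f (e i))"
    by (rule sum_convex_diagonal_le[OF V Y _ _ f]) auto
  finally have a: "(\<Sum>i<n. f (a i)) \<le> (\<Sum>i<n. f (e i))" .
  have b: "(\<Sum>i<n. f (b i)) \<le> (\<Sum>i<n. f (e i))"
    unfolding b_def by (rule sum_convex_diagonal_le[OF V Y U f])
  have "(\<Sum>i<n. f (d i)) \<le> (\<Sum>i<n. (1 - \<theta>) * f (a i) + \<theta> * f (b i))"
    using convex_onD[OF f \<theta>] d by (intro sum_mono) (simp add: add.commute)
  also have "\<dots> = (1 - \<theta>) * (\<Sum>i<n. f (a i)) + \<theta> * (\<Sum>i<n. f (b i))"
    by (simp add: sum.distrib sum_distrib_left)
  also have "\<dots> \<le> (1 - \<theta>) * (\<Sum>i<n. f (e i)) + \<theta> * (\<Sum>i<n. f (e i))"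
    using a b \<theta> by (intro add_mono mult_left_mono) auto
  finally show ?thesis by (simp add: algebra_simps)
qed

section \<open>The characteristic polynomial\<close>

text \<open>
  A case of the matrix determinant lemma. The bordered matrix \<open>?L\<close> below becomes block
  triangular in two ways: clearing the bordering row leaves \<open>?N\<close> in the corner, and clearing the
  bordering column leaves \<open>diag(d)\<close> and the Schur complement \<open>?z\<close>.
\<close>
lemma det_diag_minus_const:
  fixes d :: "nat \<Rightarrow> real"
  assumes d: "\<And>i. i < n \<Longrightarrow> d i \<noteq> 0"
  shows "det (Matrix.mat n n (\<lambda>(i, j). (if i = j then d i else 0) - l))
      = (\<Prod>i<n. d i) * (1 - l * (\<Sum>i<n. 1 / d i))"
proof -
  let ?N = "Matrix.mat n n (\<lambda>(i, j). (if i = j then d i else 0) - l)"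
  let ?c = "Matrix.mat n 1 (\<lambda>_. l)" and ?r = "Matrix.mat 1 n (\<lambda>_. 1 :: real)"
  let ?k = "Matrix.mat n 1 (\<lambda>(i, _). - l / d i)"
  let ?z = "Matrix.mat 1 1 (\<lambda>_. 1 - l * (\<Sum>i<n. 1 / d i))"
  let ?L = "four_block_mat (mat_diag n d) ?c ?r (1\<^sub>m 1)"
  have L: "?L \<in> carrier_mat (n + 1) (n + 1)" by (rule four_block_carrier_mat) auto
  have "?L = four_block_mat ?N ?c (0\<^sub>m 1 n) (1\<^sub>m 1) * four_block_mat (1\<^sub>m n) (0\<^sub>m n 1) ?r (1\<^sub>m 1)"
    by (subst mult_four_block_mat[of _ n n _ 1 _ 1])
      (auto simp: mat_diag_def scalar_prod_def intro!: eq_matI cong_four_block_mat)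
  then have "det ?L = det (four_block_mat ?N ?c (0\<^sub>m 1 n) (1\<^sub>m 1))
      * det (four_block_mat (1\<^sub>m n) (0\<^sub>m n 1) ?r (1\<^sub>m 1))"
    by (simp only:) (intro det_mult[of _ "n + 1"] four_block_carrier_mat, auto)
  also have "\<dots> = det ?N"
    by (subst det_four_block_mat_lower_left_zero[of _ n _ 1])
      (auto simp: det_four_block_mat_upper_right_zero[of _ n _ 1])
  finally have 1: "det ?L = det ?N" .
  have "?L * four_block_mat (1\<^sub>m n) ?k (0\<^sub>m 1 n) (1\<^sub>m 1) = four_block_mat (mat_diag n d) (0\<^sub>m n 1) ?r ?z"
  proof -
    have "mat_diag n d * ?k + ?c = 0\<^sub>m n 1"
      using d by (subst mat_diag_mult_left[of _ n 1]) (auto intro!: eq_matI)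
    moreover have "?r * ?k + 1\<^sub>m 1 = ?z"
      by (intro eq_matI) (auto simp: scalar_prod_def sum_distrib_left sum_negf lessThan_atLeast0)
    moreover have "mat_diag n d * 1\<^sub>m n + ?c * 0\<^sub>m 1 n = mat_diag n d"
      using right_mult_one_mat[OF mat_diag_dim] by (intro eq_matI) (auto simp: mat_diag_def)
    moreover have "?r * 1\<^sub>m n + 1\<^sub>m 1 * 0\<^sub>m 1 n = ?r"
      by (intro eq_matI) auto
    ultimately show ?thesis
      by (subst mult_four_block_mat[of _ n n _ 1 _ 1 _ _ n _ 1]) (auto simp del: One_nat_def)
  qed
  then have "det (four_block_mat (mat_diag n d) (0\<^sub>m n 1) ?r ?z)
      = det ?L * det (four_block_mat (1\<^sub>m n) ?k (0\<^sub>m 1 n) (1\<^sub>m 1))"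
    using det_mult[OF L, of "four_block_mat (1\<^sub>m n) ?k (0\<^sub>m 1 n) (1\<^sub>m 1)"]
      four_block_carrier_mat[of "1\<^sub>m n" n n "1\<^sub>m 1" 1 1 ?k "0\<^sub>m 1 n"] by (simp only: one_carrier_mat)
  also have "det (four_block_mat (1\<^sub>m n) ?k (0\<^sub>m 1 n) (1\<^sub>m 1)) = 1"
    by (subst det_four_block_mat_lower_left_zero[of _ n _ 1]) auto
  also have "det (four_block_mat (mat_diag n d) (0\<^sub>m n 1) ?r ?z) = det (mat_diag n d) * det ?z"
    by (rule det_four_block_mat_upper_right_zero) auto
  also have "det ?z = 1 - l * (\<Sum>i<n. 1 / d i)"
    by (subst det_single) auto
  also have "det (mat_diag n d) = (\<Prod>i<n. d i)"
    by (subst det_upper_triangular[of _ n])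
      (auto simp: mat_diag_def upper_triangular_def prod_list_diag_prod lessThan_atLeast0)
  finally show ?thesis using 1 by simp
qed

definition const_off_diag :: "nat \<Rightarrow> (nat \<Rightarrow> 'a) \<Rightarrow> 'a \<Rightarrow> 'a mat" where
  "const_off_diag n x l = Matrix.mat n n (\<lambda>(i, j). if i = j then x i else l)"

text \<open>
  With \<open>P = \<Prod>i<n. [:- x i, 1:]\<close>, the determinant above is \<open>P s * (1 - l * P' s / P s)\<close> at \<open>s = t + l\<close>,
  which equals \<open>(D_op l P) t\<close>. The division restricts \<open>t\<close> to the complement of a finite set,
  which still suffices to identify two polynomials.
\<close>
lemma char_poly_const_off_diag:
  "char_poly (const_off_diag n x l) = D_op l (\<Prod>i<n. [:- x i, 1:])"
proof -
  let ?M = "const_off_diag n x l" and ?P = "\<Prod>i<n. [:- x i, 1:]"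
  have M: "?M \<in> carrier_mat n n" by (simp add: const_off_diag_def)
  have eq: "poly (char_poly ?M) t = poly (D_op l ?P) t" if t: "t \<notin> (\<lambda>i. x i - l) ` {..<n}" for t
  proof -
    define d where "d = (\<lambda>i. t + l - x i)"
    have d: "d i \<noteq> 0" if "i < n" for i using t that by (force simp: d_def)
    have "- char_matrix ?M t = Matrix.mat n n (\<lambda>(i, j). (if i = j then d i else 0) - l)"
      by (intro eq_matI) (auto simp: char_matrix_def const_off_diag_def d_def)
    then have "poly (char_poly ?M) t = (\<Prod>i<n. d i) * (1 - l * (\<Sum>i<n. 1 / d i))"
      unfolding char_poly_matrix[OF M] using det_diag_minus_const[of n d] d by simp
    moreover have "poly ?P (t + l) = (\<Prod>i<n. d i)"
      by (simp add: poly_prod d_def algebra_simps)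
    moreover have "poly (pderiv ?P) (t + l) = (\<Prod>i<n. d i) * (\<Sum>i<n. 1 / d i)"
    proof -
      have "poly (pderiv ?P) (t + l) = (\<Sum>i<n. \<Prod>j\<in>{..<n} - {i}. d j)"
        by (simp add: pderiv_prod poly_sum poly_prod pderiv_pCons d_def algebra_simps)
      also have "\<dots> = (\<Sum>i<n. (\<Prod>j<n. d j) * (1 / d i))"
        using d by (intro sum.cong refl) (simp add: prod.remove[of "{..<n}"])
      finally show ?thesis by (simp add: sum_distrib_left)
    qed
    ultimately show ?thesis
      by (simp add: poly_D_op algebra_simps)
  qed
  define q where "q = char_poly ?M - D_op l ?P"
  have "- (\<lambda>i. x i - l) ` {..<n} \<subseteq> {t. poly q t = 0}"
    using eq by (auto simp: q_def)
  moreover have "infinite (- (\<lambda>i. x i - l) ` {..<n})"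
    by (simp add: Compl_eq_Diff_UNIV infinite_UNIV_char_0)
  ultimately have "q = 0"
    using poly_roots_finite finite_subset by blast
  then show ?thesis by (simp add: q_def)
qed

section \<open>Monotonicity in the spectral order\<close>

lemma proots_linear_factors: "proots (\<Prod>e\<leftarrow>es. [:-e, 1:]) = mset (es :: real list)"
proof (induction es)
  case (Cons e es)
  have "(\<Prod>e\<leftarrow>es. [:-e, 1:]) \<noteq> 0" by (auto simp: prod_list_zero_iff)
  then have "proots ([:-e, 1:] * (\<Prod>e\<leftarrow>es. [:-e, 1:])) = {#e#} + mset es"
    using Cons by (subst proots_mult) (simp_all del: mult_pCons_left)
  then show ?case by (simp del: mult_pCons_left)
qed simp

text \<open>
  Hermite--Poulain supplies the real factorization of the characteristic polynomial, and the diagonal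
  form lists exactly the zeros of \<open>D_op l P\<close>, with multiplicity.
\<close>
lemma const_off_diag_diagonalize:
  assumes "(\<Prod>i<n. [:- x i, 1:]) \<in> hyperbolic_polys n"
  obtains U es where "U \<in> carrier_mat n n" "transpose_mat U * U = 1\<^sub>m n"
    "const_off_diag n x l = U * mat_diag n ((!) es) * transpose_mat U"
    "length es = n" "proots (D_op l (\<Prod>i<n. [:- x i, 1:])) = mset es"
proof -
  let ?P = "\<Prod>i<n. [:- x i, 1:]"
  obtain E where E: "size E = n" "D_op l ?P = (\<Prod>e\<in>#E. [:-e, 1:])"
    using hyperbolic_split[OF D_op_hyperbolic[OF assms]] by blast
  obtain es where es: "mset es = E" using ex_mset by blast
  have split: "D_op l ?P = (\<Prod>e\<leftarrow>es. [:-e, 1:])"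
    unfolding E(2) es[symmetric] by (metis mset_map prod_mset_prod_list)
  have len: "length es = n" using E(1) es by auto
  have roots: "proots (D_op l ?P) = mset es"
    unfolding split by (rule proots_linear_factors)
  have "char_poly (const_off_diag n x l) = (\<Prod>e\<leftarrow>es. [:-e, 1:])"
    by (simp only: char_poly_const_off_diag split)
  moreover have "transpose_mat (const_off_diag n x l) = const_off_diag n x l"
    by (intro eq_matI) (auto simp: const_off_diag_def)
  moreover have "const_off_diag n x l \<in> carrier_mat n n"
    by (simp add: const_off_diag_def)
  ultimately obtain U where "U \<in> carrier_mat n n" "transpose_mat U * U = 1\<^sub>m n"
    "const_off_diag n x l = U * mat_diag n ((!) es) * transpose_mat U"
    using symmetric_diagonalize by blast
  then show ?thesis using len roots by (rule that)
qed

theorem theorem5: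
  fixes n :: nat and P :: "real poly" and l1 l2 :: real
  assumes "P \<in> hyperbolic_polys n"
    and "l1 * l2 \<ge> 0"
    and "\<bar>l1\<bar> \<le> \<bar>l2\<bar>"
  shows "spectral_le (D_op l1 P) (D_op l2 P)"
proof -
  obtain A where A: "size A = n" "P = (\<Prod>x\<in>#A. [:-x, 1:])"
    using hyperbolic_split[OF assms(1)] by blast
  obtain xs where xs: "mset xs = A" using ex_mset by blast
  have len: "length xs = n" using A(1) xs by auto
  define x where "x = (!) xs"
  have "P = prod_list (map (\<lambda>i. [:- x i, 1:]) [0..<n])"
  proof -
    have "P = prod_list (map (\<lambda>a. [:- a, 1:]) xs)"
      unfolding A(2) xs[symmetric] by (metis mset_map prod_mset_prod_list)
    moreover have "map (\<lambda>i. [:- x i, 1:]) [0..<n] = map (\<lambda>a. [:- a, 1:]) xs"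
      unfolding x_def len[symmetric] by (intro nth_equalityI) auto
    ultimately show ?thesis by (simp only:)
  qed
  then have P: "P = (\<Prod>i<n. [:- x i, 1:])"
    by (simp add: prod.distinct_set_conv_list[symmetric] lessThan_atLeast0)
  obtain U ds where U: "U \<in> carrier_mat n n" "transpose_mat U * U = 1\<^sub>m n"
      "const_off_diag n x l1 = U * mat_diag n ((!) ds) * transpose_mat U"
      "length ds = n" "proots (D_op l1 P) = mset ds"
    using const_off_diag_diagonalize[of x n l1] assms(1) unfolding P by metis
  obtain V es where V: "V \<in> carrier_mat n n" "transpose_mat V * V = 1\<^sub>m n"
      "const_off_diag n x l2 = V * mat_diag n ((!) es) * transpose_mat V"
      "length es = n" "proots (D_op l2 P) = mset es"
    using const_off_diag_diagonalize[of x n l2] assms(1) unfolding P by metis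
  \<comment> \<open>If \<open>l2 = 0\<close>, then \<open>l1 = 0\<close> as well, and \<open>l1 / l2 = 0\<close> is still a weight with \<open>l1 = \<theta> * l2\<close>.\<close>
  define \<theta> where "\<theta> = l1 / l2"
  have \<theta>: "0 \<le> \<theta>" "\<theta> \<le> 1" "l1 = \<theta> * l2"
    using assms(2,3)
    by (auto simp: \<theta>_def field_simps zero_le_mult_iff zero_le_divide_iff divide_le_eq abs_if
        split: if_splits)
  have diag: "const_off_diag n x l2 $$ (i, i) = x i" if "i < n" for i
    using that by (simp add: const_off_diag_def)
  have comb: "(1 - \<theta>) \<cdot>\<^sub>m mat_diag n x + \<theta> \<cdot>\<^sub>m const_off_diag n x l2 = const_off_diag n x l1"
    using \<theta>(3) by (intro eq_matI) (auto simp: const_off_diag_def mat_diag_def algebra_simps)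
  have sums: "(\<Sum>y\<in>#mset ys. f y) = (\<Sum>i<length ys. f (ys ! i))" for f :: "real \<Rightarrow> real" and ys
  proof -
    have "(\<Sum>y\<in>#mset ys. f y) = sum_list (map f ys)"
      by (metis mset_map sum_mset_sum_list)
    then show ?thesis by (simp add: sum_list_sum_nth lessThan_atLeast0)
  qed
  have "(\<Sum>i<n. f (ds ! i)) \<le> (\<Sum>i<n. f (es ! i))" if "convex_on UNIV f" for f
    using sum_convex_spectrum_le[OF U(1,2) V(1,2,3) diag _ \<theta>(1,2) that, of "(!) ds"] U(3) comb by simp
  then show ?thesis
    unfolding spectral_le_def majorized_def U(5) V(5) sums using U(4) V(4) by simp
qed

end
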